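(* For $r = 0, 1, 2$, \[ [t^r] \sum_{\lambda\in \mathcal{P}}\prod_{i\geq 1}\left[{\lambda_i-\lambda_{i+2}+1 \atop \lambda_{i+1}-\lambda_{i+2}}\right]_{t}q^{\binom{\lambda_1}{2}+|\lambda|}= [t^r] \prod_{i\geq 1}\frac{1}{(1-q^{2i-1})(1-tq^{2i})}. \]
   Context: $\mathcal{P}$ is the set of all partitions $\lambda=(\lambda_1\ge\lambda_2\ge\cdots)$, with $\lambda_i=0$ beyond the last nonzero part, and $|\lambda|=\sum\lambda_i$. $\left[{a\atop b}\right]_t$ is the Gaussian $t$-binomial coefficient. For a power series $Q$ in $t$ (with coefficients power series in $q$), $[t^r]Q$ denotes the coefficient of $t^r$. *)

theory Defs
  imports "HOL-Analysis.Analysis"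
begin

text \<open>
  Formal power series in two variables are elements of the type \<open>rat fps fps\<close>: the outer
  variable is \<open>q\<close> and the inner one is \<open>t\<close>, so that \<open>t\<close> itself is \<open>fps_const fps_X\<close> and \<open>q\<close> is
  \<open>fps_X\<close>.  The variable \<open>q\<close> has to be the outer one because the infinite sum and product below
  converge \<open>q\<close>-adically, not \<open>t\<close>-adically.
\<close>

text \<open>
  The coefficient of \<open>t ^ r\<close>, as a power series in \<open>q\<close>, under the identification of power series
  in \<open>q\<close> over power series in \<open>t\<close> with power series in \<open>t\<close> over power series in \<open>q\<close>.
\<close>
definition t_coeff :: "nat \<Rightarrow> 'a fps fps \<Rightarrow> 'a fps" where
  "t_coeff r Q = Abs_fps (\<lambda>n. fps_nth (fps_nth Q n) r)"

text \<open>Indices are shifted by one: \<open>l i\<close> stands for the part with index \<open>i + 1\<close>.\<close>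
definition partitions :: "(nat \<Rightarrow> nat) set" where
  "partitions = {l. antimono l \<and> finite {i. l i \<noteq> 0}}"

definition partition_size :: "(nat \<Rightarrow> nat) \<Rightarrow> nat" where
  "partition_size l = (\<Sum>i | l i \<noteq> 0. l i)"

definition t_factorial :: "nat \<Rightarrow> rat fps" where
  "t_factorial n = (\<Prod>i=1..n. 1 - fps_X ^ i)"

text \<open>
  The Gaussian binomial coefficient, expanded as a power series in \<open>t\<close>; the powers of \<open>1 - t\<close>
  that turn \<open>t_factorial\<close> into a product of \<open>t\<close>-integers cancel.
\<close>
definition gauss_binomial :: "nat \<Rightarrow> nat \<Rightarrow> rat fps" where
  "gauss_binomial a b =
     (if b \<le> a then t_factorial a / (t_factorial b * t_factorial (a - b)) else 0)"

lemma t_factorial_nth_0 [simp]: "fps_nth (t_factorial n) 0 = 1"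
  unfolding t_factorial_def by (induction n) (simp_all add: fps_mult_nth_0)

lemma t_factorial_nonzero [simp]: "t_factorial n \<noteq> 0"
  using t_factorial_nth_0[of n] by (metis fps_zero_nth zero_neq_one)

lemma gauss_binomial_mult:
  assumes "b \<le> a"
  shows "gauss_binomial a b * (t_factorial b * t_factorial (a - b)) = t_factorial a"
proof -
  have "is_unit (t_factorial b * t_factorial (a - b))"
    by (simp add: fps_is_unit_iff fps_mult_nth_0)
  hence "(t_factorial b * t_factorial (a - b)) dvd t_factorial a"
    using unit_imp_dvd by blast
  thus ?thesis
    using assms by (simp add: gauss_binomial_def)
qed

lemma gauss_binomial_0 [simp]: "gauss_binomial a 0 = 1"
  using gauss_binomial_mult[of 0 a] by (simp add: t_factorial_def[of 0])

lemma gauss_binomial_self [simp]: "gauss_binomial a a = 1"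
  using gauss_binomial_mult[of a a] by (simp add: t_factorial_def[of 0])

lemma gauss_binomial_Suc:
  "gauss_binomial (Suc a) (Suc b) =
     gauss_binomial a b + fps_X ^ Suc b * gauss_binomial a (Suc b)"
proof (cases "Suc b \<le> a")
  case True
  then obtain c where c: "a = Suc (b + c)" by (metis add_Suc le_Suc_ex)
  define D where "D = t_factorial (Suc b) * t_factorial (Suc c)"
  have fS: "t_factorial (Suc n) = t_factorial n * (1 - fps_X ^ Suc n)" for n
    by (simp add: t_factorial_def)
  have 1: "gauss_binomial (Suc a) (Suc b) * D = t_factorial (Suc a)"
    using gauss_binomial_mult[of "Suc b" "Suc a"] c by (simp add: D_def)
  have h2: "gauss_binomial a b * (t_factorial b * t_factorial (Suc c)) = t_factorial a"
    using gauss_binomial_mult[of b a] c by (simp add: Suc_diff_le)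
  have 2: "gauss_binomial a b * D = t_factorial a * (1 - fps_X ^ Suc b)"
  proof -
    have "D = t_factorial b * t_factorial (Suc c) * (1 - fps_X ^ Suc b)"
      by (simp only: D_def fS[of b] mult.assoc mult.commute mult.left_commute)
    thus ?thesis using h2 by (simp only: mult.assoc [symmetric])
  qed
  have h3: "gauss_binomial a (Suc b) * (t_factorial (Suc b) * t_factorial c) = t_factorial a"
    using gauss_binomial_mult[of "Suc b" a] c by simp
  have 3: "gauss_binomial a (Suc b) * D = t_factorial a * (1 - fps_X ^ Suc c)"
  proof -
    have "D = t_factorial (Suc b) * t_factorial c * (1 - fps_X ^ Suc c)"
      by (simp only: D_def fS[of c] mult.assoc)
    thus ?thesis using h3 by (simp only: mult.assoc [symmetric])
  qed
  have "(gauss_binomial a b + fps_X ^ Suc b * gauss_binomial a (Suc b)) * D =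
        gauss_binomial a b * D + fps_X ^ Suc b * (gauss_binomial a (Suc b) * D)"
    by (simp only: distrib_right mult.assoc)
  also have "\<dots> = t_factorial a * (1 - fps_X ^ Suc b * fps_X ^ Suc c)"
    unfolding 2 3 by (simp only: right_diff_distrib mult_1_right mult.left_commute)
                     (simp add: algebra_simps)
  also have "fps_X ^ Suc b * fps_X ^ Suc c = (fps_X ^ Suc a :: rat fps)"
    by (simp only: power_add [symmetric]) (simp add: c)
  also have "t_factorial a * (1 - fps_X ^ Suc a) = gauss_binomial (Suc a) (Suc b) * D"
    unfolding 1 fS ..
  finally have "gauss_binomial (Suc a) (Suc b) * D =
    (gauss_binomial a b + fps_X ^ Suc b * gauss_binomial a (Suc b)) * D" ..
  moreover have "D \<noteq> 0" by (simp add: D_def)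
  ultimately show ?thesis by simp
next
  case False
  hence "a \<le> b" by simp
  show ?thesis
  proof (cases "a = b")
    case True
    have "gauss_binomial b (Suc b) = 0" by (simp add: gauss_binomial_def)
    thus ?thesis by (simp add: True)
  next
    case False
    with \<open>a \<le> b\<close> have "a < b" by simp
    thus ?thesis by (simp add: gauss_binomial_def)
  qed
qed

text \<open>
  The infinite sum, the infinite products and the quotients in the theorem are meaningful, i.e.\
  none of them takes the default value that the library assigns to a divergent expression.
\<close>

lemma finite_partitions_le: "finite {l \<in> partitions. partition_size l \<le> n}"
proof -
  have "l i \<le> n \<and> (i \<ge> n \<longrightarrow> l i = 0)"
    if l: "l \<in> partitions" "partition_size l \<le> n" for l i
  proof -
    have fin: "finite {i. l i \<noteq> 0}" and anti: "antimono l"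
      using l by (auto simp: partitions_def)
    have *: "sum l A \<le> n" if "finite A" for A
    proof -
      have "sum l A = sum l (A \<inter> {i. l i \<noteq> 0})"
        by (rule sum.mono_neutral_right) (use that in auto)
      also have "\<dots> \<le> partition_size l"
        unfolding partition_size_def by (rule sum_mono2) (use fin in auto)
      finally show ?thesis using l by simp
    qed
    have "l i = 0" if "i \<ge> n"
    proof (rule ccontr)
      assume "l i \<noteq> 0"
      hence "1 \<le> l j" if "j \<in> {..i}" for j
        using antimonoD[OF anti, of j i] that by simp
      hence "(\<Sum>j\<in>{..i}. 1) \<le> sum l {..i}" by (rule sum_mono)
      thus False using *[of "{..i}"] that by simp
    qed
    thus ?thesis using *[of "{i}"] by simp
  qed
  hence "{l \<in> partitions. partition_size l \<le> n} \<subseteq>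
         {l. \<forall>i. (i \<in> {..<n} \<longrightarrow> l i \<in> {..n}) \<and> (i \<notin> {..<n} \<longrightarrow> l i = 0)}"
    by auto
  moreover have "finite {l. \<forall>i. (i \<in> {..<n} \<longrightarrow> l i \<in> {..n}) \<and> (i \<notin> {..<n} \<longrightarrow> l i = (0::nat))}"
    by (rule finite_set_of_finite_funs) auto
  ultimately show ?thesis by (rule finite_subset)
qed

lemma partition_sum_summable:
  fixes w :: "(nat \<Rightarrow> nat) \<Rightarrow> rat fps"
  shows "(\<lambda>l. fps_const (w l) * fps_X ^ ((l 0 choose 2) + partition_size l))
           summable_on partitions"
    (is "?F summable_on _")
proof -
  have "finite {l\<in>partitions. fps_nth (?F l) n \<noteq> 0}" for n
    by (rule finite_subset[OF _ finite_partitions_le[of n]])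
       (auto simp: fps_X_power_nth split: if_splits)
  hence "(?F has_sum Abs_fps (\<lambda>n. \<Sum>l | l \<in> partitions \<and> fps_nth (?F l) n \<noteq> 0. fps_nth (?F l) n))
           partitions"
    by (intro has_sum_fpsI) simp_all
  thus ?thesis unfolding summable_on_def by blast
qed

lemma gauss_product_has_prod:
  assumes "l \<in> partitions"
  shows "(\<lambda>i. gauss_binomial (l i - l (i + 2) + 1) (l (i + 1) - l (i + 2))) has_prod
         (\<Prod>i | l i \<noteq> 0. gauss_binomial (l i - l (i + 2) + 1) (l (i + 1) - l (i + 2)))"
proof (rule has_prod_finite)
  show "finite {i. l i \<noteq> 0}" using assms by (simp add: partitions_def)
  fix i assume "i \<notin> {i. l i \<noteq> 0}"
  moreover have "l (i + 1) \<le> l i"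
    using assms by (auto simp: partitions_def intro: antimonoD)
  ultimately show "gauss_binomial (l i - l (i + 2) + 1) (l (i + 1) - l (i + 2)) = 1" by simp
qed

lemma divide_fps_fps:
  fixes f :: "rat fps fps"
  assumes "fps_nth f 0 = 1"
  shows "1 / f * f = 1"
proof -
  have "subdegree f = 0" using assms by (simp add: subdegree_eq_0_iff)
  hence "1 / f = inverse f" by (simp add: fps_divide_def)
  moreover have "inverse (1 :: rat fps) = 1" by simp
  ultimately show ?thesis
    using assms fps_right_inverse[of f 1] by (simp add: fps_inverse_def mult.commute)
qed

lemma product_convergent:
  "convergent_prod (\<lambda>i. 1 / ((1 - fps_X ^ (2 * i + 1)) *
     (1 - fps_const fps_X * fps_X ^ (2 * i + 2))) :: rat fps fps)"
  (is "convergent_prod (\<lambda>i. 1 / ?d i)")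
proof -
  let ?f = "\<lambda>i. 1 / ?d i :: rat fps fps"
  have d0: "fps_nth (?d i) 0 = 1" for i
    by (simp add: fps_mult_nth_0)
  have fd: "?f i * ?d i = 1" for i
    by (rule divide_fps_fps) (rule d0)
  have f_nz: "?f i \<noteq> 0" for i
    using fd[of i] by (metis mult_zero_left zero_neq_one)
  have f0: "fps_nth (?f i) 0 = 1" for i
    using arg_cong[OF fd[of i], of "\<lambda>x. fps_nth x 0"] d0[of i] by (simp add: fps_mult_nth_0)
  have f1: "fps_nth (?f i - 1) k = 0" if "k \<le> i" for i k
  proof -
    have "x - 1 = x * (1 - y)" if "x * y = 1" for x y :: "rat fps fps"
      using that by (simp add: right_diff_distrib)
    from this[OF fd[of i]] have "?f i - 1 = ?f i * (1 - ?d i)" .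
    also have "1 - ?d i = fps_X ^ (2 * i + 1) *
      (1 + fps_const fps_X * fps_X * (1 - fps_X ^ (2 * i + 1)))"
      by (simp add: algebra_simps power_add)
    finally have "?f i - 1 = fps_X ^ (2 * i + 1) *
      (?f i * (1 + fps_const fps_X * fps_X * (1 - fps_X ^ (2 * i + 1))))"
      by (simp only: mult.left_commute)
    thus ?thesis using that by (simp only: fps_X_power_mult_nth) simp
  qed
  have ne1: "?f i \<noteq> 1" for i
  proof
    assume "?f i = 1"
    with fd[of i] have "?d i = 1" by (simp only: mult_1_left)
    moreover have "fps_nth (?d i) (2 * i + 1) = -1"
    proof -
      have "?d i = 1 - fps_X ^ (2 * i + 1) -
        fps_X ^ (2 * i + 2) * (fps_const fps_X * (1 - fps_X ^ (2 * i + 1)))"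
        by (simp add: algebra_simps)
      thus ?thesis
        by (simp only: fps_sub_nth fps_X_power_mult_nth) simp
    qed
    ultimately have "fps_nth (1 :: rat fps fps) (2 * i + 1) = -1" by (simp only:)
    thus False by simp
  qed
  have sub: "subdegree (?f k - 1) > n" if "k > n" for n k
  proof (rule subdegree_greaterI)
    show "?f k - 1 \<noteq> 0" using ne1[of k] by simp
    show "fps_nth (?f k - 1) i = 0" if "i \<le> n" for i
      using f1[of i k] that \<open>k > n\<close> by simp
  qed
  obtain P where P: "(\<lambda>n. \<Prod>k\<le>n. ?f k) \<longlonglongrightarrow> P"
    using tendsto_prod_fps[of ?f "\<lambda>n. n"] f_nz sub by blast
  have "P \<noteq> 0"
  proof
    assume "P = 0"
    with P have "eventually (\<lambda>n. fps_nth (\<Prod>k\<le>n. ?f k) 0 = 0) sequentially"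
      by (simp add: tendsto_fps_iff)
    then obtain n where "fps_nth (\<Prod>k\<le>n. ?f k) 0 = 0"
      by (meson eventually_sequentially order_refl)
    moreover have "fps_nth (\<Prod>k\<le>n. ?f k) 0 = 1"
      by (induction n) (simp_all only: atMost_0 atMost_Suc fps_mult_nth_0 f0 prod.insert
            finite_atMost prod.empty finite.emptyI empty_iff atMost_iff Suc_n_not_le_n mult_1_right
            not_False_eq_True fps_one_nth if_True)
    ultimately show False by simp
  qed
  with P show ?thesis
    unfolding convergent_prod_def raw_has_prod_def by (intro exI[of _ 0] exI[of _ P]) simp
qed

end

theory Submission
  imports Defs
begin

text \<open>
  Write \<open>m\<^sub>j = \<lambda>\<^sub>j - \<lambda>\<^sub>j\<^sub>+\<^sub>1\<close> (1-indexed), so that the \<open>i\<close>-th Gaussian binomial is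
  \<open>[m\<^sub>i + m\<^sub>i\<^sub>+\<^sub>1 + 1 choose m\<^sub>i\<^sub>+\<^sub>1]\<close>.  The coefficient of \<open>t\<close> in the product counts the \<open>j \<ge> 2\<close>
  with \<open>m\<^sub>j \<ge> 1\<close>; that of \<open>t\<^sup>2\<close> counts the pairs \<open>2 \<le> j \<le> k\<close> such that a column of height \<open>j\<close> and
  one of height \<open>k\<close> can both be removed from the diagram, plus the \<open>j \<ge> 1\<close> for which columns of
  heights \<open>j\<close> and \<open>j + 1\<close> can.  Removing these columns expresses the left-hand side through
  \<open>U\<^sub>k = \<Sum> q^(binom \<lambda>\<^sub>1 2 + k \<lambda>\<^sub>1 + |\<lambda>|)\<close>: its coefficients of \<open>1, t, t\<^sup>2\<close> are \<open>U\<^sub>0\<close>,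
  \<open>q\<^sup>2 U\<^sub>1 / (1 - q)\<close> and \<open>q^4 U\<^sub>2 / ((1 - q) (1 - q\<^sup>2))\<close>.  Distinguishing \<open>\<lambda>\<^sub>1 = \<lambda>\<^sub>2\<close> from \<open>\<lambda>\<^sub>1 > \<lambda>\<^sub>2\<close>
  gives \<open>U\<^sub>k = (1 + q^(k + 1)) U\<^sub>k\<^sub>+\<^sub>1\<close>, hence \<open>U\<^sub>0 = (1 + q) (1 + q\<^sup>2) \<cdots>\<close>, which Euler's identity
  identifies with the product over odd exponents.
\<close>

section \<open>Weighted generating functions\<close>

text \<open>An infinite level set would silently count as 0 because \<open>card\<close> does;
  \<open>finite_levels\<close> rules this out where additivity is needed, while transport along
  bijections and shifts hold regardless.\<close>

definition gen_fun :: "'a set \<Rightarrow> ('a \<Rightarrow> nat) \<Rightarrow> rat fps" where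
  "gen_fun A w = Abs_fps (\<lambda>n. of_nat (card {x \<in> A. w x = n}))"

definition finite_levels :: "'a set \<Rightarrow> ('a \<Rightarrow> nat) \<Rightarrow> bool" where
  "finite_levels A w \<longleftrightarrow> (\<forall>n. finite {x \<in> A. w x \<le> n})"

lemma gen_fun_nth: "fps_nth (gen_fun A w) n = of_nat (card {x \<in> A. w x = n})"
  by (simp add: gen_fun_def)

lemma finite_level_eq: "finite_levels A w \<Longrightarrow> finite {x \<in> A. w x = n}"
  unfolding finite_levels_def by (rule finite_subset[of _ "{x \<in> A. w x \<le> n}"]) auto

lemma gen_fun_bij_betw:
  assumes "bij_betw f A B" and "\<And>x. x \<in> A \<Longrightarrow> v (f x) = w x"
  shows "gen_fun B v = gen_fun A w"
proof (rule fps_ext)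
  fix n
  have "bij_betw f {x \<in> A. w x = n} {y \<in> B. v y = n}"
    using assms unfolding bij_betw_def inj_on_def by auto
  thus "fps_nth (gen_fun B v) n = fps_nth (gen_fun A w) n"
    by (simp add: gen_fun_nth bij_betw_same_card)
qed

lemma gen_fun_Un:
  assumes "finite_levels (A \<union> B) w" and "A \<inter> B = {}"
  shows "gen_fun (A \<union> B) w = gen_fun A w + gen_fun B w"
proof (rule fps_ext)
  fix n
  have "{x \<in> A \<union> B. w x = n} = {x \<in> A. w x = n} \<union> {x \<in> B. w x = n}" by auto
  moreover from this have "finite {x \<in> A. w x = n}" "finite {x \<in> B. w x = n}"
    using finite_level_eq[OF assms(1), of n] by simp_all
  ultimately show "fps_nth (gen_fun (A \<union> B) w) n = fps_nth (gen_fun A w + gen_fun B w) n"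
    using assms(2) by (simp add: gen_fun_nth, subst card_Un_disjoint) auto
qed

lemma gen_fun_shift: "gen_fun A (\<lambda>x. w x + k) = fps_X ^ k * gen_fun A w"
proof (rule fps_ext)
  fix n
  have "{x \<in> A. w x + k = n} = (if n < k then {} else {x \<in> A. w x = n - k})" by auto
  thus "fps_nth (gen_fun A (\<lambda>x. w x + k)) n = fps_nth (fps_X ^ k * gen_fun A w) n"
    by (simp add: gen_fun_nth fps_X_power_mult_nth)
qed

lemma finite_levels_Times:
  assumes "finite_levels A w" and "k > 0"
  shows "finite_levels (A \<times> UNIV) (\<lambda>(x, j). w x + k * j)"
  unfolding finite_levels_def
proof
  fix n
  have "{y \<in> A \<times> UNIV. (case y of (x, j) \<Rightarrow> w x + k * j) \<le> n} \<subseteq> {x \<in> A. w x \<le> n} \<times> {..n}"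
  proof safe
    fix x j assume "w x + k * j \<le> n"
    moreover have "j \<le> k * j" using assms(2) by simp
    ultimately show "w x \<le> n" "j \<le> n" by linarith+
  qed
  thus "finite {y \<in> A \<times> UNIV. (case y of (x, j) \<Rightarrow> w x + k * j) \<le> n}"
    by (rule finite_subset) (use assms(1) in \<open>simp add: finite_levels_def\<close>)
qed

text \<open>The pairs with j = 0 form a copy of A, and the others form a copy of the whole product
  with every weight raised by k. So the series G of the product satisfies G =
  \<open>gen_fun A w\<close> + q^k G.\<close>

lemma gen_fun_geometric:
  assumes "finite_levels A w" and "k > 0"
  shows "(1 - fps_X ^ k) * gen_fun (A \<times> UNIV) (\<lambda>(x, j). w x + k * j) = gen_fun A w"
proof -
  let ?w = "\<lambda>(x, j). w x + k * j"
  have split: "A \<times> UNIV = A \<times> {0} \<union> A \<times> range Suc"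
    by (auto simp: image_iff) (metis not0_implies_Suc)
  have "gen_fun (A \<times> UNIV) ?w = gen_fun (A \<times> {0}) ?w + gen_fun (A \<times> range Suc) ?w"
    using finite_levels_Times[OF assms] unfolding split by (rule gen_fun_Un) auto
  also have "gen_fun (A \<times> {0}) ?w = gen_fun A w"
    by (rule gen_fun_bij_betw[where f = "\<lambda>x. (x, 0)"])
       (auto simp: bij_betw_def inj_on_def image_iff)
  also have "gen_fun (A \<times> range Suc) ?w = gen_fun (A \<times> UNIV) (\<lambda>y. ?w y + k)"
    by (rule gen_fun_bij_betw[where f = "\<lambda>(x, j). (x, Suc j)"])
       (auto simp: bij_betw_def inj_on_def image_iff)
  finally show ?thesis by (simp add: gen_fun_shift left_diff_distrib diff_eq_eq)
qed

section \<open>Inserting a column into a partition\<close>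

text \<open>This is the number of columns of height j + 1 in the diagram, the \<open>m\<close> of
  the overview with its index shifted. On partitions the truncated subtraction is exact.\<close>

definition part_mult :: "(nat \<Rightarrow> nat) \<Rightarrow> nat \<Rightarrow> nat" where
  "part_mult l j = l j - l (Suc j)"

text \<open>Rows 0 to j are lengthened by one box, so the inserted column has height j + 1.\<close>

definition add_column :: "nat \<Rightarrow> (nat \<Rightarrow> nat) \<Rightarrow> nat \<Rightarrow> nat" where
  "add_column j l i = l i + of_bool (i \<le> j)"

definition del_column :: "nat \<Rightarrow> (nat \<Rightarrow> nat) \<Rightarrow> nat \<Rightarrow> nat" where
  "del_column j l i = l i - of_bool (i \<le> j)"

lemma partitions_iff:
  "l \<in> partitions \<longleftrightarrow> (\<forall>i. l (Suc i) \<le> l i) \<and> (\<exists>N. \<forall>i\<ge>N. l i = 0)"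
proof -
  have "finite {i. l i \<noteq> 0} \<longleftrightarrow> (\<exists>N. \<forall>i\<ge>N. l i = 0)"
    unfolding finite_nat_set_iff_bounded by (simp, metis linorder_not_less neq0_conv)
  thus ?thesis by (simp add: partitions_def decseq_Suc_iff)
qed

lemma partition_Suc_le: "l \<in> partitions \<Longrightarrow> l (Suc i) \<le> l i"
  by (simp add: partitions_iff)

lemma partition_mono: "l \<in> partitions \<Longrightarrow> i \<le> j \<Longrightarrow> l j \<le> l i"
  by (auto simp: partitions_def antimono_def)

lemma partition_size_eq_sum:
  assumes "\<And>i. i \<ge> N \<Longrightarrow> l i = 0"
  shows "partition_size l = sum l {..<N}"
  unfolding partition_size_def
  by (rule sum.mono_neutral_left) (use assms in \<open>force simp: linorder_not_less[symmetric]\<close>)+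

lemma add_column_partition:
  assumes "l \<in> partitions" shows "add_column j l \<in> partitions"
proof -
  obtain N where "\<forall>i\<ge>N. l i = 0" using assms by (auto simp: partitions_iff)
  hence "\<forall>i\<ge>max N (Suc j). add_column j l i = 0" by (simp add: add_column_def)
  moreover have "add_column j l (Suc i) \<le> add_column j l i" for i
    using partition_Suc_le[OF assms, of i] by (auto simp: add_column_def)
  ultimately show ?thesis unfolding partitions_iff by blast
qed

lemma mult_add_column:
  assumes "l \<in> partitions"
  shows "part_mult (add_column j l) i = part_mult l i + of_bool (i = j)"
  using partition_Suc_le[OF assms, of i] by (auto simp: part_mult_def add_column_def)

lemma del_add_column: "del_column j (add_column j l) = l"
  by (auto simp: del_column_def add_column_def)

text \<open>Row j is nonempty and the rows above it are at least as long, so the truncated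
  subtraction in \<open>del_column\<close> never cuts off at 0.\<close>

lemma column_pos:
  assumes "l \<in> partitions" "part_mult l j \<ge> 1" "i \<le> j"
  shows "l i \<ge> 1"
  using partition_mono[OF assms(1,3)] assms(2) by (simp add: part_mult_def)

lemma add_del_column:
  assumes "l \<in> partitions" "part_mult l j \<ge> 1"
  shows "add_column j (del_column j l) = l"
  using column_pos[OF assms] by (auto simp: del_column_def add_column_def)

lemma del_column_partition:
  assumes "l \<in> partitions" "part_mult l j \<ge> 1"
  shows "del_column j l \<in> partitions"
proof -
  obtain N where "\<forall>i\<ge>N. l i = 0" using assms by (auto simp: partitions_iff)
  hence "\<forall>i\<ge>N. del_column j l i = 0" by (simp add: del_column_def)
  moreover have "del_column j l (Suc i) \<le> del_column j l i" for i
    using partition_Suc_le[OF assms(1), of i] assms(2)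
    by (cases "i = j") (auto simp: del_column_def part_mult_def)
  ultimately show ?thesis unfolding partitions_iff by blast
qed

lemma mult_del_column:
  assumes "l \<in> partitions" "part_mult l j \<ge> 1"
  shows "part_mult (del_column j l) i = part_mult l i - of_bool (i = j)"
  using mult_add_column[OF del_column_partition[OF assms], of j i]
  by (simp add: add_del_column[OF assms])

lemma partition_size_add_column:
  assumes "l \<in> partitions"
  shows "partition_size (add_column j l) = partition_size l + Suc j"
proof -
  obtain N where N: "\<forall>i\<ge>N. l i = 0" using assms by (auto simp: partitions_iff)
  let ?M = "max N (Suc j)"
  have "partition_size (add_column j l) = sum (add_column j l) {..<?M}"
    by (rule partition_size_eq_sum) (use N in \<open>simp add: add_column_def\<close>)
  also have "\<dots> = sum l {..<?M} + (\<Sum>i<?M. of_bool (i \<le> j))"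
    by (simp add: add_column_def sum.distrib)
  also have "sum l {..<?M} = partition_size l"
    by (rule partition_size_eq_sum[symmetric]) (use N in simp)
  also have "(\<Sum>i<?M. of_bool (i \<le> j)) = (\<Sum>i\<le>j. 1)"
    by (rule sum.mono_neutral_cong_right) auto
  finally show ?thesis by simp
qed

section \<open>Weights and the recurrence for \<open>U\<^sub>k\<close>\<close>

definition weight :: "nat \<Rightarrow> (nat \<Rightarrow> nat) \<Rightarrow> nat" where
  "weight k l = (l 0 choose 2) + k * l 0 + partition_size l"

text \<open>Lengthening the first row raises its binomial by the old \<open>l 0\<close>, which is
  absorbed by passing from k to k + 1. The constant collects k from the linear term and j + 1 from
  the new boxes.\<close>

lemma weight_add_column:
  assumes "l \<in> partitions"
  shows "weight k (add_column j l) = weight (Suc k) l + (k + Suc j)"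
  using partition_size_add_column[OF assms, of j]
  by (simp add: weight_def add_column_def numeral_2_eq_2)

lemma weight_add_two_columns:
  assumes "l \<in> partitions"
  shows "weight 0 (add_column j (add_column k l)) = weight 2 l + (j + k + 3)"
  unfolding weight_add_column[OF add_column_partition[OF assms]] weight_add_column[OF assms]
    numeral_2_eq_2[symmetric] by simp

lemma finite_levels_weight: "finite_levels partitions (weight k)"
  unfolding finite_levels_def
proof
  fix n
  show "finite {l \<in> partitions. weight k l \<le> n}"
    by (rule finite_subset[OF _ finite_partitions_le[of n]]) (auto simp: weight_def)
qed

definition weighted_partitions :: "nat \<Rightarrow> rat fps" where
  "weighted_partitions k = gen_fun partitions (weight k)"

text \<open>Truncated subtraction sends index 0 to 0, so the first row is duplicated and the others
  move down by one.\<close>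

definition repeat_first :: "(nat \<Rightarrow> nat) \<Rightarrow> nat \<Rightarrow> nat" where
  "repeat_first l i = l (i - 1)"

lemma repeat_first_partition:
  assumes "l \<in> partitions" shows "repeat_first l \<in> partitions"
proof -
  obtain N where N: "\<forall>i\<ge>N. l i = 0" using assms by (auto simp: partitions_iff)
  hence "\<forall>i\<ge>Suc N. repeat_first l i = 0" by (simp add: repeat_first_def)
  moreover have "repeat_first l (Suc i) \<le> repeat_first l i" for i
    using partition_Suc_le[OF assms] by (cases i) (auto simp: repeat_first_def)
  ultimately show ?thesis unfolding partitions_iff by blast
qed

lemma weight_repeat_first:
  assumes "l \<in> partitions"
  shows "weight k (repeat_first l) = weight (Suc k) l"
proof -
  obtain N where N: "\<forall>i\<ge>N. l i = 0" using assms by (auto simp: partitions_iff)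
  have "partition_size (repeat_first l) = sum (repeat_first l) {..<Suc N}"
    by (rule partition_size_eq_sum) (use N in \<open>simp add: repeat_first_def\<close>)
  also have "\<dots> = l 0 + sum l {..<N}"
    by (simp add: repeat_first_def sum.lessThan_Suc_shift del: sum.lessThan_Suc)
  also have "sum l {..<N} = partition_size l"
    by (rule partition_size_eq_sum[symmetric]) (use N in simp)
  finally have "partition_size (repeat_first l) = l 0 + partition_size l" .
  moreover have "repeat_first l 0 = l 0" by (simp add: repeat_first_def)
  ultimately show ?thesis by (simp add: weight_def)
qed

text \<open>If the first two rows agree, deleting one of them moves \<open>l 0\<close> boxes into
  the linear term of the weight. Otherwise a column of height 1 can be deleted, at the cost of a
  factor q^(k + 1). Both maps are bijections onto all partitions.\<close>

lemma weighted_partitions_rec: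
  "weighted_partitions k = (1 + fps_X ^ Suc k) * weighted_partitions (Suc k)"
proof -
  let ?A = "{l \<in> partitions. part_mult l 0 = 0}" and ?B = "{l \<in> partitions. part_mult l 0 \<ge> 1}"
  have part: "partitions = ?A \<union> ?B" by auto
  have "weighted_partitions k = gen_fun ?A (weight k) + gen_fun ?B (weight k)"
    unfolding weighted_partitions_def
    by (subst (1) part, rule gen_fun_Un) (use finite_levels_weight part in auto)
  also have "gen_fun ?A (weight k) = gen_fun partitions (weight (Suc k))"
  proof (rule gen_fun_bij_betw[where f = repeat_first])
    have "l \<circ> Suc \<in> partitions" if "l \<in> partitions" for l
      using that by (auto simp: partitions_iff) (metis Suc_leD le_SucI le_Suc_eq)
    moreover have "repeat_first (l \<circ> Suc) = l" if "l \<in> partitions" "part_mult l 0 = 0" for l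
    proof
      fix i
      show "repeat_first (l \<circ> Suc) i = l i"
        using that partition_Suc_le[of l 0] by (cases i) (auto simp: repeat_first_def part_mult_def)
    qed
    ultimately show "bij_betw repeat_first partitions ?A"
      by (intro bij_betwI[where g = "\<lambda>l. l \<circ> Suc"])
         (auto simp: repeat_first_partition part_mult_def repeat_first_def fun_eq_iff)
  qed (rule weight_repeat_first)
  also have "gen_fun ?B (weight k) = gen_fun partitions (\<lambda>l. weight (Suc k) l + (k + Suc 0))"
  proof (rule gen_fun_bij_betw[where f = "add_column 0"])
    show "bij_betw (add_column 0) partitions ?B"
      by (rule bij_betwI[where g = "del_column 0"])
         (auto simp: add_column_partition del_column_partition mult_add_column
            del_add_column add_del_column)
  qed (rule weight_add_column)
  finally show ?thesis
    unfolding gen_fun_shift by (simp add: weighted_partitions_def distrib_right)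
qed

section \<open>Marked partitions\<close>

text \<open>Index j marks a removable column of height j + 2: heights start at 2 here, and
  \<open>part_mult\<close> is itself shifted by one.\<close>

definition marked1 :: "(nat \<Rightarrow> nat) \<Rightarrow> nat set" where
  "marked1 l = {j. part_mult l (Suc j) \<ge> 1}"

text \<open>The pair marks columns of heights k + 2 and j + 2 that can be removed together; on the
  diagonal the subtraction demands two columns of the same height.\<close>

definition marked2 :: "(nat \<Rightarrow> nat) \<Rightarrow> (nat \<times> nat) set" where
  "marked2 l = {(k, j). j \<le> k \<and> part_mult l (Suc j) \<ge> 1 \<and> part_mult l (Suc k) - of_bool (k = j) \<ge> 1}"

definition marked_adjacent :: "(nat \<Rightarrow> nat) \<Rightarrow> nat set" where
  "marked_adjacent l = {j. part_mult l j \<ge> 1 \<and> part_mult l (Suc j) \<ge> 1}"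

text \<open>Removing the marked column leaves an arbitrary partition and an arbitrary j. The weight
  lost is j + 2, and summing over j gives the geometric series.\<close>

lemma gen_fun_marked1:
  "(1 - fps_X) * gen_fun (Sigma partitions marked1) (\<lambda>y. weight 0 (fst y)) =
     fps_X ^ 2 * weighted_partitions 1"
proof -
  have "gen_fun (Sigma partitions marked1) (\<lambda>y. weight 0 (fst y)) =
        gen_fun (partitions \<times> UNIV) (\<lambda>y. (case y of (l, j) \<Rightarrow> weight 1 l + 1 * j) + 2)"
  proof (rule gen_fun_bij_betw[where f = "\<lambda>(l, j). (add_column (Suc j) l, j)"])
    show "bij_betw (\<lambda>(l, j). (add_column (Suc j) l, j)) (partitions \<times> UNIV)
            (Sigma partitions marked1)"
      by (rule bij_betwI[where g = "\<lambda>(l, j). (del_column (Suc j) l, j)"])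
         (auto simp: marked1_def add_column_partition del_column_partition mult_add_column
            del_add_column add_del_column)
  qed (auto simp: weight_add_column)
  also have "\<dots> = fps_X ^ 2 * gen_fun (partitions \<times> UNIV) (\<lambda>(l, j). weight 1 l + 1 * j)"
    by (rule gen_fun_shift)
  finally show ?thesis
    using gen_fun_geometric[OF finite_levels_weight[of 1], of 1]
    by (simp add: weighted_partitions_def mult.left_commute)
qed

text \<open>Removing both columns costs j + (j + 1) + 3 = 2 j + 4, hence the step 2 of the geometric
  series and the factor q^4.\<close>

lemma gen_fun_marked_adjacent:
  "(1 - fps_X ^ 2) * gen_fun (Sigma partitions marked_adjacent) (\<lambda>y. weight 0 (fst y)) =
     fps_X ^ 4 * weighted_partitions 2"
proof -
  have "gen_fun (Sigma partitions marked_adjacent) (\<lambda>y. weight 0 (fst y)) =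
        gen_fun (partitions \<times> UNIV) (\<lambda>y. (case y of (l, j) \<Rightarrow> weight 2 l + 2 * j) + 4)"
  proof (rule gen_fun_bij_betw[where f = "\<lambda>(l, j). (add_column j (add_column (Suc j) l), j)"])
    show "bij_betw (\<lambda>(l, j). (add_column j (add_column (Suc j) l), j)) (partitions \<times> UNIV)
            (Sigma partitions marked_adjacent)"
      by (rule bij_betwI[where g = "\<lambda>(l, j). (del_column (Suc j) (del_column j l), j)"])
         (auto simp: marked_adjacent_def add_column_partition del_column_partition mult_add_column
            mult_del_column del_add_column add_del_column)
  qed (auto simp: weight_add_two_columns)
  also have "\<dots> = fps_X ^ 4 * gen_fun (partitions \<times> UNIV) (\<lambda>(l, j). weight 2 l + 2 * j)"
    by (rule gen_fun_shift)
  finally show ?thesis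
    using gen_fun_geometric[OF finite_levels_weight[of 2], of 2]
    by (simp add: weighted_partitions_def mult.left_commute)
qed

lemma gen_fun_marked2:
  "(1 - fps_X) * (1 - fps_X ^ 2) *
     gen_fun (Sigma partitions marked2) (\<lambda>y. weight 0 (fst y)) =
     fps_X ^ 5 * weighted_partitions 2"
proof -
  let ?w = "\<lambda>(l, b). weight 2 l + 1 * b"
  \<comment> \<open>With k = j + b the condition j \<le> k disappears and j, b become independent.
    The cost of the two columns is b + 2 j + 5, which yields two geometric series with steps 1 and
    2.\<close>
  let ?f = "\<lambda>((l, b), j). (add_column (Suc j) (add_column (Suc (j + b)) l), j + b, j)"
  let ?g = "\<lambda>(l, k, j). ((del_column (Suc k) (del_column (Suc j) l), k - j), j)"
  have "gen_fun (Sigma partitions marked2) (\<lambda>y. weight 0 (fst y)) =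
        gen_fun ((partitions \<times> UNIV) \<times> UNIV) (\<lambda>z. (case z of (y, j) \<Rightarrow> ?w y + 2 * j) + 5)"
  proof (rule gen_fun_bij_betw[where f = ?f])
    show "bij_betw ?f ((partitions \<times> UNIV) \<times> UNIV) (Sigma partitions marked2)"
      by (rule bij_betwI[where g = ?g])
         (auto simp: marked2_def add_column_partition del_column_partition mult_add_column
            mult_del_column del_add_column add_del_column)
  qed (auto simp: weight_add_two_columns)
  also have "\<dots> = fps_X ^ 5 *
      gen_fun ((partitions \<times> UNIV) \<times> UNIV) (\<lambda>(y, j). ?w y + 2 * j)"
    by (rule gen_fun_shift)
  finally have "(1 - fps_X ^ 2) * gen_fun (Sigma partitions marked2) (\<lambda>y. weight 0 (fst y)) =
      fps_X ^ 5 * gen_fun (partitions \<times> UNIV) ?w"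
    using gen_fun_geometric[OF finite_levels_Times[OF finite_levels_weight[of 2]], of 1 2]
    by (simp add: mult.left_commute)
  thus ?thesis
    using gen_fun_geometric[OF finite_levels_weight[of 2], of 1]
    by (simp add: weighted_partitions_def mult.left_commute mult.assoc)
qed

section \<open>Coefficients of the summands\<close>

text \<open>The Gaussian binomial enumerates by size the partitions that fit in a box of sides b and
  a - b. The conditions say whether the empty partition, the single box, and the two partitions of 2
  fit. The proof uses the Pascal recurrence instead of this interpretation.\<close>

lemma gauss_binomial_nth:
  "fps_nth (gauss_binomial a b) 0 = of_bool (b \<le> a)"
  "fps_nth (gauss_binomial a b) 1 = of_bool (1 \<le> b \<and> b < a)"
  "fps_nth (gauss_binomial a b) 2 = of_bool (1 \<le> b \<and> b + 2 \<le> a) + of_bool (2 \<le> b \<and> b < a)"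
proof -
  have "fps_nth (gauss_binomial a b) 0 = of_bool (b \<le> a) \<and>
    fps_nth (gauss_binomial a b) 1 = of_bool (1 \<le> b \<and> b < a) \<and>
    fps_nth (gauss_binomial a b) 2 = of_bool (1 \<le> b \<and> b + 2 \<le> a) + of_bool (2 \<le> b \<and> b < a)"
  proof (induction a arbitrary: b)
    case 0
    show ?case by (cases b) (auto simp: gauss_binomial_def[of 0 "Suc _"])
  next
    case (Suc a)
    show ?case
    proof (cases b)
      case (Suc c)
      \<comment> \<open>The second term of the recurrence carries t^(c + 1), so for c \<ge> 2 it
        does not reach the coefficients up to t^2.\<close>
      consider "c = 0" | "c = 1" | "c \<ge> 2" by linarith
      thus ?thesis
        using Suc.IH[of c] Suc.IH[of "Suc c"] unfolding Suc gauss_binomial_Suc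
        by cases (auto simp: fps_X_power_mult_nth simp del: power_Suc)
    qed auto
  qed
  thus "fps_nth (gauss_binomial a b) 0 = of_bool (b \<le> a)"
    "fps_nth (gauss_binomial a b) 1 = of_bool (1 \<le> b \<and> b < a)"
    "fps_nth (gauss_binomial a b) 2 = of_bool (1 \<le> b \<and> b + 2 \<le> a) + of_bool (2 \<le> b \<and> b < a)"
    by blast+
qed

lemma fps_mult_nth_2:
  "fps_nth (f * g) 2 =
     fps_nth f 0 * fps_nth g 2 + fps_nth f 1 * fps_nth g 1 + fps_nth f 2 * fps_nth g 0"
  by (simp add: fps_mult_nth numeral_2_eq_2)

lemma fps_prod_nth:
  fixes f :: "nat \<Rightarrow> 'a :: comm_ring_1 fps"
  assumes "\<And>i. fps_nth (f i) 0 = 1"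
  shows "fps_nth (\<Prod>i<N. f i) 0 = 1"
    and "fps_nth (\<Prod>i<N. f i) 1 = (\<Sum>i<N. fps_nth (f i) 1)"
    and "fps_nth (\<Prod>i<N. f i) 2 =
           (\<Sum>i<N. fps_nth (f i) 2 + (\<Sum>j<i. fps_nth (f j) 1 * fps_nth (f i) 1))"
proof -
  show 0: "fps_nth (\<Prod>i<N. f i) 0 = 1" for N
    by (induction N) (simp_all add: assms)
  show 1: "fps_nth (\<Prod>i<N. f i) 1 = (\<Sum>i<N. fps_nth (f i) 1)" for N
    by (induction N) (use 0 assms in \<open>simp_all add: fps_mult_nth_1\<close>)
  show "fps_nth (\<Prod>i<N. f i) 2 =
          (\<Sum>i<N. fps_nth (f i) 2 + (\<Sum>j<i. fps_nth (f j) 1 * fps_nth (f i) 1))"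
    by (induction N)
       (use 0 1 assms in \<open>simp_all add: fps_mult_nth_2 sum_distrib_right del: One_nat_def\<close>)
qed

section \<open>Low coefficients of the Gaussian product of a partition\<close>

definition gauss_product :: "(nat \<Rightarrow> nat) \<Rightarrow> rat fps" where
  "gauss_product l = (\<Prod>i. gauss_binomial (l i - l (i + 2) + 1) (l (i + 1) - l (i + 2)))"

text \<open>The difference \<open>l i - l (i + 2)\<close> telescopes into two consecutive column
  multiplicities. Beyond the support each factor is the binomial of 1 over 0, so the product may be
  cut at any N past the support.\<close>

lemma gauss_product_eq:
  assumes l: "l \<in> partitions" and N: "\<And>i. i \<ge> N \<Longrightarrow> l i = 0"
  shows "gauss_product l =
    (\<Prod>i<N. gauss_binomial (part_mult l i + part_mult l (Suc i) + 1) (part_mult l (Suc i)))"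
proof -
  let ?F = "\<lambda>i. gauss_binomial (l i - l (i + 2) + 1) (l (i + 1) - l (i + 2))"
  have "gauss_product l = (\<Prod>i | l i \<noteq> 0. ?F i)"
    unfolding gauss_product_def using has_prod_unique[OF gauss_product_has_prod[OF l]] by simp
  also have "\<dots> = (\<Prod>i<N. ?F i)"
  proof (rule prod.mono_neutral_left)
    show "{i. l i \<noteq> 0} \<subseteq> {..<N}" using N by (force simp: linorder_not_less[symmetric])
    show "\<forall>i\<in>{..<N} - {i. l i \<noteq> 0}. ?F i = 1"
    proof
      fix i assume "i \<in> {..<N} - {i. l i \<noteq> 0}"
      thus "?F i = 1" using partition_Suc_le[OF l, of i] by simp
    qed
  qed simp
  also have "\<dots> = (\<Prod>i<N. gauss_binomial (part_mult l i + part_mult l (Suc i) + 1)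
      (part_mult l (Suc i)))"
    using partition_Suc_le[OF l] by (intro prod.cong) (simp_all add: part_mult_def)
  finally show ?thesis .
qed

text \<open>The i-th factor belongs to a box with sides \<open>part_mult l (Suc i)\<close> and
  \<open>part_mult l i + 1\<close>. Its t^2 coefficient contributes an adjacent pair and a diagonal
  element of \<open>marked2\<close>; products of t coefficients from two different factors give the
  off-diagonal elements.\<close>

lemma
  assumes l: "l \<in> partitions"
  shows finite_marked: "finite (marked1 l)" "finite (marked2 l)" "finite (marked_adjacent l)"
    and gauss_product_nth:
      "fps_nth (gauss_product l) 0 = 1"
      "fps_nth (gauss_product l) 1 = of_nat (card (marked1 l))"
      "fps_nth (gauss_product l) 2 = of_nat (card (marked2 l)) + of_nat (card (marked_adjacent l))"
proof -
  obtain N where N: "\<And>i. i \<ge> N \<Longrightarrow> l i = 0" using l by (auto simp: partitions_iff)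
  have zero: "part_mult l (Suc j) = 0" if "j \<ge> N" for j
    using N[of "Suc j"] that by (simp add: part_mult_def)
  have lt: "j < N" if "part_mult l (Suc j) \<ge> 1" for j
    using zero[of j] that by (cases "j < N") auto
  let ?Q = "\<lambda>k j. part_mult l (Suc j) \<ge> 1 \<and> part_mult l (Suc k) - of_bool (k = j) \<ge> 1"
  let ?g = "\<lambda>i. gauss_binomial (part_mult l i + part_mult l (Suc i) + 1) (part_mult l (Suc i))"
  have m1: "marked1 l = {..<N} \<inter> {j. part_mult l (Suc j) \<ge> 1}"
    and ma: "marked_adjacent l = {..<N} \<inter> {j. part_mult l j \<ge> 1 \<and> part_mult l (Suc j) \<ge> 1}"
    using lt by (auto simp: marked1_def marked_adjacent_def)
  have m2: "marked2 l = Sigma {..<N} (\<lambda>k. {..k} \<inter> {j. ?Q k j})"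
    using lt by (fastforce simp: marked2_def)
  show "finite (marked1 l)" "finite (marked2 l)" "finite (marked_adjacent l)"
    unfolding m1 m2 ma by auto
  have g: "gauss_product l = (\<Prod>i<N. ?g i)" by (rule gauss_product_eq[OF l N])
  have g0: "fps_nth (?g i) 0 = 1" for i by (simp add: gauss_binomial_nth)
  have g1: "fps_nth (?g i) 1 = of_bool (part_mult l (Suc i) \<ge> 1)" for i
    unfolding gauss_binomial_nth by simp
  have g2: "fps_nth (?g i) 2 = of_bool (part_mult l i \<ge> 1 \<and> part_mult l (Suc i) \<ge> 1) +
      of_bool (part_mult l (Suc i) \<ge> 2)" for i
    unfolding gauss_binomial_nth by (auto simp: of_bool_def)
  show "fps_nth (gauss_product l) 0 = 1"
    unfolding g by (rule fps_prod_nth) (rule g0)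
  show "fps_nth (gauss_product l) 1 = of_nat (card (marked1 l))"
    unfolding g fps_prod_nth(2)[of ?g, OF g0] g1 m1 by (simp add: sum_of_bool_eq)
  have "fps_nth (gauss_product l) 2 =
    (\<Sum>i<N. of_bool (part_mult l i \<ge> 1 \<and> part_mult l (Suc i) \<ge> 1)) +
    (\<Sum>i<N. of_bool (part_mult l (Suc i) \<ge> 2) +
      (\<Sum>j<i. of_bool (part_mult l (Suc j) \<ge> 1) * of_bool (part_mult l (Suc i) \<ge> 1)))"
    unfolding g fps_prod_nth(3)[of ?g, OF g0] g1 g2 by (simp add: sum.distrib add.assoc)
  also have "(\<Sum>i<N. of_bool (part_mult l i \<ge> 1 \<and> part_mult l (Suc i) \<ge> 1)) =
      (of_nat (card (marked_adjacent l)) :: rat)"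
    unfolding ma by (simp add: sum_of_bool_eq)
  also have "(\<Sum>i<N. of_bool (part_mult l (Suc i) \<ge> 2) +
      (\<Sum>j<i. of_bool (part_mult l (Suc j) \<ge> 1) * of_bool (part_mult l (Suc i) \<ge> 1))) =
      (\<Sum>i<N. \<Sum>j\<le>i. of_bool (?Q i j) :: rat)"
  proof (rule sum.cong)
    fix i
    \<comment> \<open>The diagonal term j = i is split off: there \<open>?Q\<close> says that the
      multiplicity is at least 2.\<close>
    have "(\<Sum>j\<le>i. of_bool (?Q i j) :: rat) = of_bool (?Q i i) + (\<Sum>j<i. of_bool (?Q i j))"
      by (simp add: lessThan_Suc_atMost[symmetric] del: of_bool_conj)
    also have "(\<Sum>j<i. of_bool (?Q i j)) =
        (\<Sum>j<i. of_bool (part_mult l (Suc j) \<ge> 1) * of_bool (part_mult l (Suc i) \<ge> 1) :: rat)"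
      by (rule sum.cong) auto
    also have "of_bool (?Q i i) = (of_bool (part_mult l (Suc i) \<ge> 2) :: rat)"
      by (auto simp: of_bool_def)
    finally show "of_bool (part_mult l (Suc i) \<ge> 2) +
      (\<Sum>j<i. of_bool (part_mult l (Suc j) \<ge> 1) * of_bool (part_mult l (Suc i) \<ge> 1)) =
      (\<Sum>j\<le>i. of_bool (?Q i j) :: rat)" ..
  qed simp
  also have "\<dots> = of_nat (card (marked2 l))"
    unfolding m2 by (subst card_SigmaI) (simp_all add: sum_of_bool_eq del: of_bool_conj)
  finally show "fps_nth (gauss_product l) 2 =
      of_nat (card (marked2 l)) + of_nat (card (marked_adjacent l))"
    by (simp add: add.commute)
qed

lemma gen_fun_Sigma_nth:
  assumes "finite_levels A w" and "\<And>x. x \<in> A \<Longrightarrow> finite (I x)"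
  shows "fps_nth (gen_fun (Sigma A I) (\<lambda>y. w (fst y))) n =
    (\<Sum>x | x \<in> A \<and> w x = n. of_nat (card (I x)))"
proof -
  have "{y \<in> Sigma A I. w (fst y) = n} = Sigma {x \<in> A. w x = n} I" by auto
  thus ?thesis
    using assms finite_level_eq[OF assms(1)] by (simp add: gen_fun_nth card_SigmaI)
qed

section \<open>The sum side as generating functions of marked partitions\<close>

definition partition_series :: "rat fps fps" where
  "partition_series = (\<Sum>\<^sub>\<infinity>l\<in>partitions.
     fps_const (gauss_product l) * fps_X ^ ((l 0 choose 2) + partition_size l))"

text \<open>The infinite sum converges q-adically: only the finitely many partitions of weight n
  touch the coefficient of q^n, so extracting the coefficient of t^r commutes with the sum.\<close>

lemma partition_series_nth:
  "fps_nth (t_coeff r partition_series) n =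
     (\<Sum>l | l \<in> partitions \<and> weight 0 l = n. fps_nth (gauss_product l) r)"
proof -
  let ?F = "\<lambda>l. fps_const (gauss_product l) * fps_X ^ ((l 0 choose 2) + partition_size l)"
  have F: "fps_nth (?F l) n = (if weight 0 l = n then gauss_product l else 0)" for l n
    by (auto simp: weight_def)
  have fin: "finite {l \<in> partitions. weight 0 l = n}" for n
    by (rule finite_level_eq[OF finite_levels_weight])
  have "(?F has_sum Abs_fps (\<lambda>n. \<Sum>l | l \<in> partitions \<and> weight 0 l = n. gauss_product l)) partitions"
  proof (rule has_sum_fpsI)
    fix n
    show "finite {l \<in> partitions. fps_nth (?F l) n \<noteq> 0}"
      unfolding F by (rule finite_subset[OF _ fin[of n]]) auto
    show "fps_nth (Abs_fps (\<lambda>n. \<Sum>l | l \<in> partitions \<and> weight 0 l = n. gauss_product l)) n =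
      (\<Sum>l | l \<in> partitions \<and> fps_nth (?F l) n \<noteq> 0. fps_nth (?F l) n)"
      unfolding F fps_nth_Abs_fps by (rule sum.mono_neutral_cong_right[OF fin[of n]]) auto
  qed
  hence eq: "partition_series = Abs_fps (\<lambda>n. \<Sum>l | l \<in> partitions \<and> weight 0 l = n. gauss_product l)"
    unfolding partition_series_def by (rule infsumI)
  show ?thesis unfolding eq by (simp add: t_coeff_def fps_sum_nth)
qed

lemma t_coeff_partition_series:
  "t_coeff 0 partition_series = weighted_partitions 0"
  "t_coeff 1 partition_series = gen_fun (Sigma partitions marked1) (\<lambda>y. weight 0 (fst y))"
  "t_coeff 2 partition_series = gen_fun (Sigma partitions marked2) (\<lambda>y. weight 0 (fst y)) +
     gen_fun (Sigma partitions marked_adjacent) (\<lambda>y. weight 0 (fst y))"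
proof -
  note S = gen_fun_Sigma_nth[OF finite_levels_weight]
  show "t_coeff 0 partition_series = weighted_partitions 0"
    by (rule fps_ext)
       (simp add: partition_series_nth weighted_partitions_def gen_fun_nth gauss_product_nth)
  show "t_coeff 1 partition_series = gen_fun (Sigma partitions marked1) (\<lambda>y. weight 0 (fst y))"
    by (rule fps_ext)
       (simp add: partition_series_nth S finite_marked gauss_product_nth del: One_nat_def)
  show "t_coeff 2 partition_series = gen_fun (Sigma partitions marked2) (\<lambda>y. weight 0 (fst y)) +
     gen_fun (Sigma partitions marked_adjacent) (\<lambda>y. weight 0 (fst y))"
    by (rule fps_ext)
       (simp add: partition_series_nth S finite_marked gauss_product_nth sum.distrib)
qed

section \<open>The product side\<close>

text \<open>Convergence means that each coefficient is eventually constant, and coefficient n of a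
  product involves only coefficients up to n.\<close>

lemma tendsto_fps_mult:
  fixes f g :: "'b \<Rightarrow> 'a :: ring fps"
  assumes "(f \<longlongrightarrow> a) F" and "(g \<longlongrightarrow> b) F"
  shows "((\<lambda>x. f x * g x) \<longlongrightarrow> a * b) F"
  unfolding tendsto_fps_iff
proof
  fix n
  have "eventually (\<lambda>x. \<forall>i\<in>{..n}. fps_nth (f x) i = fps_nth a i) F"
    and "eventually (\<lambda>x. \<forall>i\<in>{..n}. fps_nth (g x) i = fps_nth b i) F"
    using assms unfolding tendsto_fps_iff by (auto intro: eventually_ball_finite)
  thus "eventually (\<lambda>x. fps_nth (f x * g x) n = fps_nth (a * b) n) F"
    by eventually_elim (auto simp: fps_mult_nth intro!: sum.cong)
qed

lemma tendsto_fps_dvdI: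
  fixes f :: "nat \<Rightarrow> 'a :: comm_ring_1 fps"
  assumes "\<And>N. fps_X ^ N dvd f N - a"
  shows "f \<longlonglongrightarrow> a"
  unfolding tendsto_fps_iff
proof
  fix n
  have "fps_nth (f N) n = fps_nth a n" if N: "N > n" for N
  proof -
    obtain h where "f N - a = fps_X ^ N * h" using assms[of N] by (auto elim: dvdE)
    hence "fps_nth (f N - a) n = 0" using N by (simp add: fps_X_power_mult_nth)
    thus ?thesis by simp
  qed
  thus "eventually (\<lambda>N. fps_nth (f N) n = fps_nth a n) sequentially"
    using eventually_gt_at_top[of n] by (rule eventually_mono[rotated])
qed

text \<open>A nonempty partition has \<open>l 0\<close> \<ge> 1 and therefore weight at least N, so
  below q^N only the empty partition contributes.\<close>

lemma tendsto_weighted_partitions: "weighted_partitions \<longlonglongrightarrow> 1"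
proof (rule tendsto_fps_dvdI)
  fix N
  show "fps_X ^ N dvd weighted_partitions N - 1"
  proof -
    have "fps_nth (weighted_partitions N) n = fps_nth 1 n" if n: "n < N" for n
    proof -
      have zero: "l = (\<lambda>_. 0)" if l: "l \<in> partitions" "weight N l = n" for l
      proof
        have "l 0 = 0"
          using l n by (cases "l 0") (auto simp: weight_def)
        thus "l i = 0" for i using partition_mono[OF l(1), of 0 i] by simp
      qed
      have empty: "(\<lambda>_. 0) \<in> partitions" "weight N (\<lambda>_. 0) = 0"
        by (auto simp: partitions_iff weight_def partition_size_def)
      have "{l \<in> partitions. weight N l = n} = (if n = 0 then {\<lambda>_. 0::nat} else {})"
      proof (intro equalityI subsetI)
        fix l assume "l \<in> {l \<in> partitions. weight N l = n}"
        hence "l = (\<lambda>_. 0)" "weight N l = n" using zero by blast+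
        thus "l \<in> (if n = 0 then {\<lambda>_. 0::nat} else {})" using empty(2) by simp
      next
        fix l :: "nat \<Rightarrow> nat" assume "l \<in> (if n = 0 then {\<lambda>_. 0::nat} else {})"
        hence "n = 0" "l = (\<lambda>_. 0)" by (simp_all split: if_splits)
        thus "l \<in> {l \<in> partitions. weight N l = n}" using empty by simp
      qed
      thus ?thesis by (simp add: weighted_partitions_def gen_fun_nth)
    qed
    hence "weighted_partitions N - 1 = fps_X ^ N * fps_shift N (weighted_partitions N - 1)"
      by (intro fps_ext) (simp add: fps_X_power_mult_nth)
    thus ?thesis by (metis dvd_triv_left)
  qed
qed

section \<open>Distinct parts against odd parts\<close>

lemma weighted_partitions_0:
  "weighted_partitions 0 = (\<Prod>i<N. 1 + fps_X ^ Suc i) * weighted_partitions N"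
proof (induction N)
  case (Suc N)
  thus ?case using weighted_partitions_rec[of N] by (simp add: mult.assoc)
qed simp

text \<open>
  Multiplying by \<open>(1 - q) \<cdots> (1 - q^N)\<close> turns the left-hand product into
  \<open>(1 - q) \<cdots> (1 - q^(2 N))\<close>.
\<close>
lemma tendsto_distinct_odd:
  "(\<lambda>N. (\<Prod>i<N. 1 + fps_X ^ Suc i) * (\<Prod>i<N. 1 - fps_X ^ (2 * i + 1))) \<longlonglongrightarrow> (1 :: rat fps)"
proof (rule tendsto_fps_dvdI)
  fix N
  let ?E = "\<lambda>N. (\<Prod>i<N. 1 + fps_X ^ Suc i) * (\<Prod>i<N. 1 - fps_X ^ (2 * i + 1)) :: rat fps"
  let ?F = "\<lambda>N. \<Prod>i<N. 1 - fps_X ^ Suc i :: rat fps"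
  have EF: "?E N * ?F N = ?F (2 * N)" for N
  proof (induction N)
    case (Suc N)
    have *: "(1 + fps_X ^ Suc N) * (1 - fps_X ^ Suc N) = (1 - fps_X ^ Suc (2 * N + 1) :: rat fps)"
      by (simp add: algebra_simps flip: power_add mult_2)
    have "?E (Suc N) * ?F (Suc N) =
      ?E N * ?F N * (1 - fps_X ^ (2 * N + 1)) * ((1 + fps_X ^ Suc N) * (1 - fps_X ^ Suc N))"
      by (simp only: prod.lessThan_Suc mult_ac)
    also have "\<dots> = ?F (Suc (Suc (2 * N)))"
      unfolding Suc.IH * by (simp add: mult.assoc)
    finally show ?case by simp
  qed simp
  \<comment> \<open>Each factor of \<open>?F\<close> with index at least N is congruent to 1 modulo
    q^N.\<close>
  have dvd: "fps_X ^ N dvd ?F (N + k) - ?F N" for k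
  proof (induction k)
    case (Suc k)
    have "?F (N + Suc k) - ?F N = (?F (N + k) - ?F N) - fps_X ^ N * (fps_X ^ Suc k * ?F (N + k))"
      by (simp add: algebra_simps power_add)
    thus ?case using Suc.IH by (metis dvd_diff dvd_triv_left)
  qed simp
  have "fps_nth (?F N) 0 = 1" by (induction N) simp_all
  \<comment> \<open>Invertibility of \<open>?F N\<close> lets it be cancelled from the divisibility
    by q^N.\<close>
  hence unit: "is_unit (?F N)" by (simp add: fps_is_unit_iff)
  have "(?E N - 1) * ?F N = ?F (2 * N) - ?F N"
    by (simp only: left_diff_distrib EF mult_1_left)
  hence "fps_X ^ N dvd (?E N - 1) * ?F N" using dvd[of N] by (simp only: mult_2)
  thus "fps_X ^ N dvd ?E N - 1" using unit by (simp only: dvd_mult_unit_iff)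
qed

section \<open>Coefficients of the finite products\<close>

lemma t_coeff_mult_1_minus_q:
  "t_coeff r (Q * (1 - fps_X ^ m)) = t_coeff r Q * (1 - fps_X ^ m :: rat fps)"
  by (rule fps_ext) (simp add: t_coeff_def right_diff_distrib fps_X_power_mult_right_nth)

lemma t_coeff_mult_1_minus_tq:
  fixes Q :: "rat fps fps"
  shows "t_coeff r (Q * (1 - fps_const fps_X * fps_X ^ m)) =
    t_coeff r Q - (if r = 0 then 0 else fps_X ^ m * t_coeff (r - 1) Q)"
proof (rule fps_ext)
  fix n
  have "Q * (1 - fps_const fps_X * fps_X ^ m) = Q - (Q * fps_const fps_X) * fps_X ^ m"
    by (simp add: algebra_simps)
  thus "fps_nth (t_coeff r (Q * (1 - fps_const fps_X * fps_X ^ m))) n =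
    fps_nth (t_coeff r Q - (if r = 0 then 0 else fps_X ^ m * t_coeff (r - 1) Q)) n"
    by (simp add: t_coeff_def fps_X_power_mult_right_nth fps_X_power_mult_nth)
qed

definition factor :: "nat \<Rightarrow> rat fps fps" where
  "factor i = 1 / ((1 - fps_X ^ (2 * i + 1)) * (1 - fps_const fps_X * fps_X ^ (2 * i + 2)))"

lemma factor_mult:
  "factor i * ((1 - fps_X ^ (2 * i + 1)) * (1 - fps_const fps_X * fps_X ^ (2 * i + 2))) = 1"
  unfolding factor_def by (rule divide_fps_fps) (simp add: fps_mult_nth_0)

definition partial_coeff :: "nat \<Rightarrow> nat \<Rightarrow> rat fps" where
  "partial_coeff r N = t_coeff r (\<Prod>i<N. factor i)"

lemma partial_coeff_0_right: "partial_coeff r 0 = of_bool (r = 0)"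
  by (rule fps_ext) (auto simp: partial_coeff_def t_coeff_def)

text \<open>This compares coefficients of t^r after multiplying the product of N + 1 factors by the
  denominator of the last one, which avoids division.\<close>

lemma partial_coeff_Suc:
  "(partial_coeff r (Suc N) -
      (if r = 0 then 0 else fps_X ^ (2 * N + 2) * partial_coeff (r - 1) (Suc N))) *
    (1 - fps_X ^ (2 * N + 1)) = partial_coeff r N"
proof -
  let ?P = "\<lambda>N. \<Prod>i<N. factor i"
  have "?P N = ?P N *
      (factor N * ((1 - fps_X ^ (2 * N + 1)) * (1 - fps_const fps_X * fps_X ^ (2 * N + 2))))"
    by (simp only: factor_mult mult_1_right)
  also have "\<dots> = ?P (Suc N) * (1 - fps_const fps_X * fps_X ^ (2 * N + 2)) * (1 - fps_X ^ (2 * N + 1))"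
    by (simp only: prod.lessThan_Suc mult_ac)
  finally show ?thesis
    unfolding partial_coeff_def
    by (metis (no_types, lifting) t_coeff_mult_1_minus_q t_coeff_mult_1_minus_tq)
qed

lemma one_minus_X_power_nonzero: "m > 0 \<Longrightarrow> (1 - fps_X ^ m :: rat fps) \<noteq> 0"
  by (metis diff_zero fps_X_power_nth fps_nonzeroI fps_one_nth fps_sub_nth less_numeral_extra(3)
      one_neq_zero)

lemma partial_coeff_0: "partial_coeff 0 N * (\<Prod>i<N. 1 - fps_X ^ (2 * i + 1)) = 1"
proof (induction N)
  case (Suc N)
  have e: "partial_coeff 0 N = partial_coeff 0 (Suc N) * (1 - fps_X ^ (2 * N + 1))"
    using partial_coeff_Suc[of 0 N] by simp
  have "partial_coeff 0 N * (\<Prod>i<N. 1 - fps_X ^ (2 * i + 1)) =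
      partial_coeff 0 (Suc N) * (\<Prod>i<Suc N. 1 - fps_X ^ (2 * i + 1))"
    unfolding e prod.lessThan_Suc by (simp only: mult_ac)
  thus ?case using Suc.IH by (simp only:)
qed (simp add: partial_coeff_0_right)

text \<open>The coefficient of t in the product of the 1 / (1 - t q^(2 i)) for i from 1 to N is q^2
  + q^4 + ... + q^(2 N). The odd factors contribute \<open>partial_coeff 0 N\<close>, and the
  denominator 1 - q^2 is cleared.\<close>

lemma partial_coeff_1:
  "partial_coeff 1 N * (1 - fps_X ^ 2) = fps_X ^ 2 * (1 - fps_X ^ (2 * N)) * partial_coeff 0 N"
proof (induction N)
  case (Suc N)
  \<comment> \<open>With q^2 and q^(2 N) named, the induction step becomes a polynomial identity for
    \<open>algebra\<close>. The recurrence runs from N + 1 down to N through the factor u, which is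
    cancelled at the end.\<close>
  define u x y where "u = (1 - fps_X ^ (2 * N + 1) :: rat fps)"
    and "x = (fps_X ^ 2 :: rat fps)" and "y = (fps_X ^ (2 * N) :: rat fps)"
  have pow: "fps_X ^ (2 * N + 2) = y * x" "fps_X ^ (2 * Suc N) = y * x"
    by (simp_all add: x_def y_def power_add flip: power2_eq_square)
  have e0: "partial_coeff 0 N = partial_coeff 0 (Suc N) * u"
    using partial_coeff_Suc[of 0 N] by (simp add: u_def)
  have e1: "partial_coeff 1 N = (partial_coeff 1 (Suc N) - y * x * partial_coeff 0 (Suc N)) * u"
    using partial_coeff_Suc[of 1 N] by (simp add: u_def flip: pow)
  have "partial_coeff 1 N * (1 - x) = x * (1 - y) * partial_coeff 0 N"
    using Suc.IH by (simp add: x_def y_def)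
  hence "u * (partial_coeff 1 (Suc N) * (1 - x)) = u * (x * (1 - y * x) * partial_coeff 0 (Suc N))"
    unfolding e0 e1 by algebra
  moreover have "u \<noteq> 0" unfolding u_def by (rule one_minus_X_power_nonzero) simp
  ultimately have "partial_coeff 1 (Suc N) * (1 - x) = x * (1 - y * x) * partial_coeff 0 (Suc N)"
    by (metis mult_left_cancel)
  thus ?case unfolding pow x_def .
qed (simp add: partial_coeff_0_right)

text \<open>The coefficients of t^r in the even factors are the complete homogeneous symmetric
  polynomials in q^2, ..., q^(2 N). The second divided by the first is q^2 (1 - q^(2 N + 2)) / (1 -
  q^4).\<close>

lemma partial_coeff_2:
  "partial_coeff 2 N * (1 - fps_X ^ 4) =
     fps_X ^ 2 * (1 - fps_X ^ (2 * N + 2)) * partial_coeff 1 N"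
proof (induction N)
  case (Suc N)
  define u x y where "u = (1 - fps_X ^ (2 * N + 1) :: rat fps)"
    and "x = (fps_X ^ 2 :: rat fps)" and "y = (fps_X ^ (2 * N) :: rat fps)"
  have pow: "fps_X ^ (2 * N + 2) = y * x" "fps_X ^ (2 * Suc N + 2) = y * x * x"
      "fps_X ^ 4 = x * x" "fps_X ^ (2 * Suc N) = y * x"
    by (simp_all add: x_def y_def flip: power_add)
  have e1: "partial_coeff 1 N = (partial_coeff 1 (Suc N) - y * x * partial_coeff 0 (Suc N)) * u"
    using partial_coeff_Suc[of 1 N] by (simp add: u_def flip: pow)
  have e2: "partial_coeff 2 N = (partial_coeff 2 (Suc N) - y * x * partial_coeff 1 (Suc N)) * u"
    using partial_coeff_Suc[of 2 N] by (simp add: u_def flip: pow)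
  have "partial_coeff 1 (Suc N) * (1 - x) = x * (1 - y * x) * partial_coeff 0 (Suc N)"
    using partial_coeff_1[of "Suc N"] unfolding pow x_def .
  moreover have "partial_coeff 2 N * (1 - x * x) = x * (1 - y * x) * partial_coeff 1 N"
    using Suc.IH unfolding pow x_def .
  ultimately have "u * (partial_coeff 2 (Suc N) * (1 - x * x)) =
      u * (x * (1 - y * x * x) * partial_coeff 1 (Suc N))"
    unfolding e1 e2 by algebra
  moreover have "u \<noteq> 0" unfolding u_def by (rule one_minus_X_power_nonzero) simp
  ultimately have "partial_coeff 2 (Suc N) * (1 - x * x) =
      x * (1 - y * x * x) * partial_coeff 1 (Suc N)"
    by (metis mult_left_cancel)
  thus ?case unfolding pow x_def .
qed (simp add: partial_coeff_0_right)

section \<open>Passage to the infinite product\<close>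

lemma convergent_prod_fps_LIMSEQ:
  fixes f :: "nat \<Rightarrow> 'a :: idom fps"
  assumes "convergent_prod f" and nz: "\<And>i. f i \<noteq> 0"
  shows "(\<lambda>N. \<Prod>i\<le>N. f i) \<longlonglongrightarrow> prodinf f"
proof -
  \<comment> \<open>\<open>convergent_prod\<close> only supplies a nonzero limit for some tail; the
    first M factors are multiplied back below, and \<open>nz\<close> keeps the full limit
    nonzero.\<close>
  obtain M p where p: "(\<lambda>n. \<Prod>i\<le>n. f (i + M)) \<longlonglongrightarrow> p" "p \<noteq> 0"
    using assms(1) by (auto simp: convergent_prod_def raw_has_prod_def)
  have "(\<Prod>i<n + M. f i) = (\<Prod>i<M. f i) * (\<Prod>i<n. f (i + M))" for n
    by (induction n) (simp_all add: mult.assoc)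
  from this[of "Suc _"]
  have "(\<Prod>i\<le>n + M. f i) = (\<Prod>i<M. f i) * (\<Prod>i\<le>n. f (i + M))" for n
    by (simp only: add_Suc lessThan_Suc_atMost)
  hence "(\<lambda>n. \<Prod>i\<le>n + M. f i) \<longlonglongrightarrow> (\<Prod>i<M. f i) * p"
    using tendsto_fps_mult[OF tendsto_const p(1)] by (simp only:)
  hence lim: "(\<lambda>N. \<Prod>i\<le>N. f i) \<longlonglongrightarrow> (\<Prod>i<M. f i) * p"
    by (rule LIMSEQ_offset)
  hence "f has_prod ((\<Prod>i<M. f i) * p)"
    using p(2) nz by (simp add: has_prod_def raw_has_prod_def)
  thus ?thesis using lim has_prod_unique by metis
qed

lemma tendsto_partial_coeff: "partial_coeff r \<longlonglongrightarrow> t_coeff r (prodinf factor)"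
proof -
  have "convergent_prod factor"
    using product_convergent by (simp only: factor_def[abs_def])
  moreover have "factor i \<noteq> 0" for i
    using factor_mult[of i] by (metis mult_zero_left zero_neq_one)
  ultimately have "(\<lambda>N. \<Prod>i\<le>N. factor i) \<longlonglongrightarrow> prodinf factor"
    by (rule convergent_prod_fps_LIMSEQ)
  hence "(\<lambda>N. \<Prod>i<N. factor i) \<longlonglongrightarrow> prodinf factor"
    by (simp only: LIMSEQ_lessThan_iff_atMost[where f = "prod factor"])
  hence ev: "\<forall>\<^sub>F N in sequentially. fps_nth (\<Prod>i<N. factor i) n = fps_nth (prodinf factor) n"
    for n by (simp only: tendsto_fps_iff)
  show ?thesis
    unfolding tendsto_fps_iff partial_coeff_def t_coeff_def fps_nth_Abs_fps
  proof
    fix n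
    show "\<forall>\<^sub>F N in sequentially. fps_nth (fps_nth (\<Prod>i<N. factor i) n) r =
        fps_nth (fps_nth (prodinf factor) n) r"
      using ev[of n] by (rule eventually_mono) simp
  qed
qed

text \<open>Euler's identity: \<open>?D N * ?O N\<close> tends to 1 and
  \<open>partial_coeff 0 N\<close> is the inverse of \<open>?O N\<close>, so \<open>?D\<close> has
  the limit of \<open>partial_coeff 0\<close>. Multiplied by \<open>weighted_partitions N\<close>,
  which tends to 1, \<open>?D N\<close> is constantly \<open>U\<^sub>0\<close>.\<close>

lemma t_coeff_0_prodinf: "t_coeff 0 (prodinf factor) = weighted_partitions 0"
proof -
  let ?D = "\<lambda>N. \<Prod>i<N. 1 + fps_X ^ Suc i :: rat fps"
  let ?O = "\<lambda>N. \<Prod>i<N. 1 - fps_X ^ (2 * i + 1) :: rat fps"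
  have eq: "partial_coeff 0 N * (?D N * ?O N) = ?D N" for N
    by (simp only: mult.left_commute[of "partial_coeff 0 N"] partial_coeff_0 mult_1_right)
  have "?D \<longlonglongrightarrow> t_coeff 0 (prodinf factor)"
    using tendsto_fps_mult[OF tendsto_partial_coeff[of 0] tendsto_distinct_odd]
    by (simp only: eq mult_1_right)
  from tendsto_fps_mult[OF this tendsto_weighted_partitions]
  have "(\<lambda>_::nat. weighted_partitions 0) \<longlonglongrightarrow> t_coeff 0 (prodinf factor)"
    by (simp only: weighted_partitions_0[symmetric] mult_1_right)
  thus ?thesis by (simp add: LIMSEQ_const_iff)
qed

lemma tendsto_1_minus_X_power:
  fixes k :: "nat \<Rightarrow> nat"
  assumes "\<And>N. N \<le> k N"
  shows "(\<lambda>N. 1 - fps_X ^ k N) \<longlonglongrightarrow> (1 :: rat fps)"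
  by (rule tendsto_fps_dvdI) (simp add: assms le_imp_power_dvd)

lemma t_coeff_1_prodinf:
  "t_coeff 1 (prodinf factor) * (1 - fps_X ^ 2) = fps_X ^ 2 * t_coeff 0 (prodinf factor)"
proof (rule LIMSEQ_unique)
  show "(\<lambda>N. partial_coeff 1 N * (1 - fps_X ^ 2)) \<longlonglongrightarrow>
      t_coeff 1 (prodinf factor) * (1 - fps_X ^ 2)"
    by (intro tendsto_fps_mult tendsto_partial_coeff tendsto_const)
  have "(\<lambda>N. fps_X ^ 2 * (1 - fps_X ^ (2 * N)) * partial_coeff 0 N) \<longlonglongrightarrow>
      fps_X ^ 2 * 1 * t_coeff 0 (prodinf factor)"
    by (intro tendsto_fps_mult tendsto_partial_coeff tendsto_const tendsto_1_minus_X_power) simp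
  thus "(\<lambda>N. partial_coeff 1 N * (1 - fps_X ^ 2)) \<longlonglongrightarrow>
      fps_X ^ 2 * t_coeff 0 (prodinf factor)"
    by (simp only: partial_coeff_1 mult_1_right)
qed

lemma t_coeff_2_prodinf:
  "t_coeff 2 (prodinf factor) * (1 - fps_X ^ 4) = fps_X ^ 2 * t_coeff 1 (prodinf factor)"
proof (rule LIMSEQ_unique)
  show "(\<lambda>N. partial_coeff 2 N * (1 - fps_X ^ 4)) \<longlonglongrightarrow>
      t_coeff 2 (prodinf factor) * (1 - fps_X ^ 4)"
    by (intro tendsto_fps_mult tendsto_partial_coeff tendsto_const)
  have "(\<lambda>N. fps_X ^ 2 * (1 - fps_X ^ (2 * N + 2)) * partial_coeff 1 N) \<longlonglongrightarrow>
      fps_X ^ 2 * 1 * t_coeff 1 (prodinf factor)"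
    by (intro tendsto_fps_mult tendsto_partial_coeff tendsto_const tendsto_1_minus_X_power) simp
  thus "(\<lambda>N. partial_coeff 2 N * (1 - fps_X ^ 4)) \<longlonglongrightarrow>
      fps_X ^ 2 * t_coeff 1 (prodinf factor)"
    by (simp only: partial_coeff_2 mult_1_right)
qed

section \<open>Comparison of both sides\<close>

lemma t_coeff_1_eq: "t_coeff 1 partition_series = t_coeff 1 (prodinf factor)"
proof -
  define x where "x = (fps_X :: rat fps)"
  have "(1 - x) * t_coeff 1 partition_series = x ^ 2 * weighted_partitions 1"
    using gen_fun_marked1 by (simp only: t_coeff_partition_series x_def)
  moreover have "weighted_partitions 0 = (1 + x) * weighted_partitions 1"
    using weighted_partitions_rec[of 0] by (simp add: x_def)
  moreover have "t_coeff 1 (prodinf factor) * (1 - x ^ 2) = x ^ 2 * weighted_partitions 0"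
    using t_coeff_1_prodinf by (simp only: t_coeff_0_prodinf x_def)
  \<comment> \<open>Since \<open>U\<^sub>0\<close> = (1 + q) \<open>U\<^sub>1\<close>, both sides
    equal q^2 \<open>U\<^sub>0\<close>.\<close>
  ultimately have "(1 - x ^ 2) * t_coeff 1 partition_series = (1 - x ^ 2) * t_coeff 1 (prodinf factor)"
    by algebra
  moreover have "1 - x ^ 2 \<noteq> 0" unfolding x_def by (rule one_minus_X_power_nonzero) simp
  ultimately show ?thesis by (metis mult_left_cancel)
qed

text \<open>On the sum side q^5 + q^4 (1 - q) = q^4 merges A and B into q^4 \<open>U\<^sub>2\<close>
  / ((1 - q) (1 - q^2)). The product side is q^4 \<open>U\<^sub>0\<close> / ((1 - q^2) (1 - q^4)),
  and \<open>U\<^sub>0\<close> = (1 + q) (1 + q^2) \<open>U\<^sub>2\<close> makes the two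
  agree.\<close>

lemma t_coeff_2_eq: "t_coeff 2 partition_series = t_coeff 2 (prodinf factor)"
proof -
  define x where "x = (fps_X :: rat fps)"
  define A B where "A = gen_fun (Sigma partitions marked2) (\<lambda>y. weight 0 (fst y))"
    and "B = gen_fun (Sigma partitions marked_adjacent) (\<lambda>y. weight 0 (fst y))"
  have "(1 - x) * (1 - x ^ 2) * A = x ^ 5 * weighted_partitions 2"
    using gen_fun_marked2 by (simp only: x_def A_def)
  moreover have "(1 - x ^ 2) * B = x ^ 4 * weighted_partitions 2"
    using gen_fun_marked_adjacent by (simp only: x_def B_def)
  moreover have "t_coeff 2 partition_series = A + B"
    by (simp only: t_coeff_partition_series A_def B_def)
  moreover have "weighted_partitions 0 = (1 + x) * weighted_partitions 1"
    using weighted_partitions_rec[of 0] by (simp add: x_def)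
  moreover have "weighted_partitions 1 = (1 + x ^ 2) * weighted_partitions 2"
    using weighted_partitions_rec[of 1] by (simp add: x_def numeral_2_eq_2)
  moreover have "t_coeff 1 (prodinf factor) * (1 - x ^ 2) = x ^ 2 * weighted_partitions 0"
    using t_coeff_1_prodinf by (simp only: t_coeff_0_prodinf x_def)
  moreover have "t_coeff 2 (prodinf factor) * (1 - x ^ 4) = x ^ 2 * t_coeff 1 (prodinf factor)"
    using t_coeff_2_prodinf by (simp only: x_def)
  ultimately have "(1 - x ^ 2) * (1 - x ^ 4) * t_coeff 2 partition_series =
      (1 - x ^ 2) * (1 - x ^ 4) * t_coeff 2 (prodinf factor)"
    by algebra
  moreover have "1 - x ^ 2 \<noteq> 0" "1 - x ^ 4 \<noteq> 0"
    unfolding x_def by (rule one_minus_X_power_nonzero, simp)+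
  hence "(1 - x ^ 2) * (1 - x ^ 4) \<noteq> 0" by simp
  ultimately show ?thesis by (metis mult_left_cancel)
qed

theorem theorem3p4:
  fixes r :: nat
  assumes "r \<in> {0, 1, 2}"
  shows
    "t_coeff r
       (\<Sum>\<^sub>\<infinity>l\<in>partitions.
          fps_const (\<Prod>i. gauss_binomial (l i - l (i + 2) + 1) (l (i + 1) - l (i + 2))) *
          fps_X ^ ((l 0 choose 2) + partition_size l)) =
     t_coeff r
       (\<Prod>i. 1 / ((1 - fps_X ^ (2 * i + 1)) * (1 - fps_const fps_X * fps_X ^ (2 * i + 2))))"
proof -
  have "t_coeff r partition_series = t_coeff r (prodinf factor)"
    using assms t_coeff_partition_series(1) t_coeff_0_prodinf t_coeff_1_eq t_coeff_2_eq by auto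
  thus ?thesis by (simp only: partition_series_def gauss_product_def factor_def[abs_def])
qed

end
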